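(* Let $Q$ be a rack. Then the mappings $\alpha\mapsto\mathrm{Dis}_\alpha$ and $N\mapsto\mathrm{con}_N$ form a monotone Galois connection between $\mathrm{Con}(Q)$ and $\mathrm{Norm}(Q)$; that is, both mappings are monotone and, for every $\alpha\in\mathrm{Con}(Q)$ and $N\in\mathrm{Norm}(Q)$, $\mathrm{Dis}_\alpha\le N$ if and only if $\alpha\le\mathrm{con}_N$.
   Context: A left quasigroup is a nonempty set $Q$ with two binary operations $*,\backslash$ satisfying $x\backslash(x*y)=y=x*(x\backslash y)$; write $L_a(b)=a*b$, a permutation of $Q$. A rack is a left quasigroup satisfying $x*(y*z)=(x*y)*(x*z)$. $\mathrm{LMlt}(Q)=\langle L_a:a\in Q\rangle$, $\mathrm{Dis}(Q)=\langle L_aL_b^{-1}:a,b\in Q\rangle$. $\mathrm{Con}(Q)$ is the lattice of congruences of $Q$ (equivalences compatible with $*$ and $\backslash$), and $\mathrm{Norm}(Q)$ is the lattice of all subgroups of $\mathrm{Dis}(Q)$ that are normal in $\mathrm{LMlt}(Q)$, both ordered by inclusion. For $\alpha\in\mathrm{Con}(Q)$, $\mathrm{Dis}_\alpha=\langle L_aL_b^{-1}: a\,\alpha\,b\rangle$ (for racks it is an element of $\mathrm{Norm}(Q)$). For $N\in\mathrm{Norm}(Q)$, $\mathrm{con}_N=\{(a,b)\in Q^2:L_aL_b^{-1}\in N\}$ (for racks it is a congruence). *)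

theory Defs
  imports "HOL-Algebra.Algebra"
begin

record 'a lquasigroup = "'a partial_object" +
  lq_mult :: "['a, 'a] \<Rightarrow> 'a" (infixl \<open>\<ast>\<index>\<close> 70)
  lq_div :: "['a, 'a] \<Rightarrow> 'a" (infixl \<open>\<bsol>\<index>\<close> 70)

locale left_quasigroup =
  fixes Q (structure)
  assumes nonempty: "carrier Q \<noteq> {}"
    and mult_closed: "\<lbrakk>x \<in> carrier Q; y \<in> carrier Q\<rbrakk> \<Longrightarrow> x \<ast> y \<in> carrier Q"
    and div_closed: "\<lbrakk>x \<in> carrier Q; y \<in> carrier Q\<rbrakk> \<Longrightarrow> x \<bsol> y \<in> carrier Q"
    and div_mult: "\<lbrakk>x \<in> carrier Q; y \<in> carrier Q\<rbrakk> \<Longrightarrow> x \<bsol> (x \<ast> y) = y"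
    and mult_div: "\<lbrakk>x \<in> carrier Q; y \<in> carrier Q\<rbrakk> \<Longrightarrow> x \<ast> (x \<bsol> y) = y"

locale rack = left_quasigroup +
  assumes left_distrib:
    "\<lbrakk>x \<in> carrier Q; y \<in> carrier Q; z \<in> carrier Q\<rbrakk> \<Longrightarrow> x \<ast> (y \<ast> z) = (x \<ast> y) \<ast> (x \<ast> z)"

(* The restriction to the carrier makes L_a an element of the group BijGroup (carrier Q),
   whose elements are extensional functions. *)
definition left_translation :: "('a, 'b) lquasigroup_scheme \<Rightarrow> 'a \<Rightarrow> 'a \<Rightarrow> 'a" where
  "left_translation Q a = (\<lambda>b\<in>carrier Q. a \<ast>\<^bsub>Q\<^esub> b)"

abbreviation Sym :: "('a, 'b) lquasigroup_scheme \<Rightarrow> ('a \<Rightarrow> 'a) monoid" where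
  "Sym Q \<equiv> BijGroup (carrier Q)"

(* L_a L_b^{-1} *)
definition displacement :: "('a, 'b) lquasigroup_scheme \<Rightarrow> 'a \<Rightarrow> 'a \<Rightarrow> 'a \<Rightarrow> 'a" where
  "displacement Q a b =
     left_translation Q a \<otimes>\<^bsub>Sym Q\<^esub> inv\<^bsub>Sym Q\<^esub> left_translation Q b"

definition LMlt :: "('a, 'b) lquasigroup_scheme \<Rightarrow> ('a \<Rightarrow> 'a) set" where
  "LMlt Q = generate (Sym Q) {left_translation Q a | a. a \<in> carrier Q}"

definition Dis :: "('a, 'b) lquasigroup_scheme \<Rightarrow> ('a \<Rightarrow> 'a) set" where
  "Dis Q = generate (Sym Q) {displacement Q a b | a b. a \<in> carrier Q \<and> b \<in> carrier Q}"

definition congruence :: "('a, 'b) lquasigroup_scheme \<Rightarrow> ('a \<times> 'a) set \<Rightarrow> bool" where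
  "congruence Q \<alpha> \<longleftrightarrow> equiv (carrier Q) \<alpha> \<and>
     (\<forall>a b c d. (a, b) \<in> \<alpha> \<and> (c, d) \<in> \<alpha> \<longrightarrow>
        (a \<ast>\<^bsub>Q\<^esub> c, b \<ast>\<^bsub>Q\<^esub> d) \<in> \<alpha> \<and> (a \<bsol>\<^bsub>Q\<^esub> c, b \<bsol>\<^bsub>Q\<^esub> d) \<in> \<alpha>)"

definition Con :: "('a, 'b) lquasigroup_scheme \<Rightarrow> ('a \<times> 'a) set gorder" where
  "Con Q = \<lparr>carrier = {\<alpha>. congruence Q \<alpha>}, eq = (=), le = (\<subseteq>)\<rparr>"

definition Norm :: "('a, 'b) lquasigroup_scheme \<Rightarrow> ('a \<Rightarrow> 'a) set gorder" where
  "Norm Q = \<lparr>carrier = {N. subgroup N (Sym Q\<lparr>carrier := Dis Q\<rparr>) \<and>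
                            N \<lhd> Sym Q\<lparr>carrier := LMlt Q\<rparr>},
             eq = (=), le = (\<subseteq>)\<rparr>"

definition Dis_cong :: "('a, 'b) lquasigroup_scheme \<Rightarrow> ('a \<times> 'a) set \<Rightarrow> ('a \<Rightarrow> 'a) set" where
  "Dis_cong Q \<alpha> = generate (Sym Q) {displacement Q a b | a b. (a, b) \<in> \<alpha>}"

definition con_sub :: "('a, 'b) lquasigroup_scheme \<Rightarrow> ('a \<Rightarrow> 'a) set \<Rightarrow> ('a \<times> 'a) set" where
  "con_sub Q N = {(a, b) \<in> carrier Q \<times> carrier Q. displacement Q a b \<in> N}"

end

theory Submission
  imports Defs
begin

text \<open>
  Left distributivity says that each \<open>L\<^sub>c\<close> is an automorphism of the rack, so every \<open>f\<close> in the left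
  multiplication group satisfies \<open>f L\<^sub>a f\<^sup>-\<^sup>1 = L\<^bsub>f a\<^esub>\<close> (\<open>conj_left_translation\<close>). Both maps of
  the connection are well defined for this reason.

  If \<open>\<alpha>\<close> is a congruence, the conjugate of a generator \<open>L\<^sub>a L\<^sub>b\<^sup>-\<^sup>1\<close> of \<open>Dis\<^sub>\<alpha>\<close> by \<open>f\<close> is
  \<open>L\<^bsub>f a\<^esub> L\<^bsub>f b\<^esub>\<^sup>-\<^sup>1\<close>, and \<open>f\<close> preserves \<open>\<alpha>\<close>. So the generating set is stable under
  conjugation and \<open>Dis\<^sub>\<alpha>\<close> is normal.

  If \<open>N\<close> is normal, \<open>con\<^sub>N\<close> is the kernel of the map \<open>a \<mapsto> N L\<^sub>a\<close> into the quotient group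
  \<open>LMlt / N\<close>. Since \<open>L\<^bsub>a * b\<^esub> = L\<^sub>a L\<^sub>b L\<^sub>a\<^sup>-\<^sup>1\<close> and dually for left division, this map sends the rack
  operations to conjugation in the quotient, and the kernel of a homomorphism is a congruence.

  The adjunction itself only says that a subgroup contains \<open>Dis\<^sub>\<alpha>\<close> as soon as it contains its
  generators, and monotonicity of both maps follows formally from it.
\<close>

section \<open>Left translations as permutations\<close>

sublocale left_quasigroup \<subseteq> Sym: group "Sym Q"
  by (rule group_BijGroup)

context left_quasigroup
begin

lemma left_translation_closed: "a \<in> carrier Q \<Longrightarrow> left_translation Q a \<in> carrier (Sym Q)"
  unfolding BijGroup_def Bij_def left_translation_def
  by (auto intro!: bij_betw_byWitness[where f' = "\<lambda>x. a \<bsol> x"]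
      simp: mult_closed div_closed div_mult mult_div)

lemma Sym_apply_closed: "f \<in> carrier (Sym Q) \<Longrightarrow> x \<in> carrier Q \<Longrightarrow> f x \<in> carrier Q"
  using Bij_imp_funcset[of f "carrier Q"] by (auto simp: BijGroup_def)

lemma Sym_mult_apply:
  "\<lbrakk>f \<in> carrier (Sym Q); g \<in> carrier (Sym Q); x \<in> carrier Q\<rbrakk> \<Longrightarrow> (f \<otimes>\<^bsub>Sym Q\<^esub> g) x = f (g x)"
  by (simp add: BijGroup_def compose_def)

lemma Sym_one_apply: "x \<in> carrier Q \<Longrightarrow> \<one>\<^bsub>Sym Q\<^esub> x = x"
  by (simp add: BijGroup_def)

lemma Sym_eqI:
  assumes "f \<in> carrier (Sym Q)" "g \<in> carrier (Sym Q)" "\<And>x. x \<in> carrier Q \<Longrightarrow> f x = g x"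
  shows "f = g"
  using assms by (auto simp: BijGroup_def Bij_def intro: extensionalityI)

lemma left_translation_apply: "x \<in> carrier Q \<Longrightarrow> left_translation Q a x = a \<ast> x"
  by (simp add: left_translation_def)

lemma inv_left_translation_apply:
  assumes a: "a \<in> carrier Q" and x: "x \<in> carrier Q"
  shows "(inv\<^bsub>Sym Q\<^esub> left_translation Q a) x = a \<bsol> x"
proof -
  let ?L = "left_translation Q a"
  have "(inv\<^bsub>Sym Q\<^esub> ?L) (?L (a \<bsol> x)) = (inv\<^bsub>Sym Q\<^esub> ?L \<otimes>\<^bsub>Sym Q\<^esub> ?L) (a \<bsol> x)"
    by (subst Sym_mult_apply) (use a x in \<open>auto simp: left_translation_closed div_closed\<close>)
  also have "\<dots> = a \<bsol> x"
    using a x by (simp add: left_translation_closed div_closed Sym_one_apply)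
  finally show ?thesis
    using a x by (simp add: left_translation_apply div_closed mult_div)
qed

lemma displacement_closed:
  "\<lbrakk>a \<in> carrier Q; b \<in> carrier Q\<rbrakk> \<Longrightarrow> displacement Q a b \<in> carrier (Sym Q)"
  by (simp add: displacement_def left_translation_closed)

section \<open>The left multiplication group\<close>

lemma subgroup_LMlt: "subgroup (LMlt Q) (Sym Q)"
  unfolding LMlt_def by (rule Sym.generate_is_subgroup) (auto simp: left_translation_closed)

lemma LMlt_closed: "f \<in> LMlt Q \<Longrightarrow> f \<in> carrier (Sym Q)"
  using subgroup.subset[OF subgroup_LMlt] by blast

lemma left_translation_in_LMlt: "a \<in> carrier Q \<Longrightarrow> left_translation Q a \<in> LMlt Q"
  unfolding LMlt_def by (auto intro: generate.incl)

lemma displacement_in_LMlt: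
  "\<lbrakk>a \<in> carrier Q; b \<in> carrier Q\<rbrakk> \<Longrightarrow> displacement Q a b \<in> LMlt Q"
  unfolding displacement_def using subgroup_LMlt left_translation_in_LMlt
  by (simp add: subgroup.m_closed subgroup.m_inv_closed)

lemma group_LMlt: "group (Sym Q\<lparr>carrier := LMlt Q\<rparr>)"
  using Sym.subgroup_imp_group[OF subgroup_LMlt] .

lemma subgroup_Dis: "subgroup (Dis Q) (Sym Q)"
  unfolding Dis_def by (rule Sym.generate_is_subgroup) (auto simp: displacement_closed)

lemma congruence_carrier:
  "congruence Q \<alpha> \<Longrightarrow> (a, b) \<in> \<alpha> \<Longrightarrow> a \<in> carrier Q \<and> b \<in> carrier Q"
  unfolding congruence_def equiv_def by blast

text \<open>Compatibility with \<open>\<ast>\<close> gives this for the generators \<open>L\<^sub>c\<close>, and compatibility with \<open>\<bsol>\<close> for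
  their inverses.\<close>

lemma LMlt_preserves_congruence:
  assumes cong: "congruence Q \<alpha>" and f: "f \<in> LMlt Q" and ab: "(a, b) \<in> \<alpha>"
  shows "(f a, f b) \<in> \<alpha>"
  using f ab unfolding LMlt_def
proof (induction f arbitrary: a b rule: generate.induct)
  case one
  then show ?case using congruence_carrier[OF cong] by (simp add: Sym_one_apply)
next
  case (incl h)
  then obtain c where c: "c \<in> carrier Q" "h = left_translation Q c" by blast
  have "(c, c) \<in> \<alpha>"
    using cong c(1) by (auto simp: congruence_def equiv_def refl_on_def)
  then have "(c \<ast> a, c \<ast> b) \<in> \<alpha>"
    using cong incl.prems by (auto simp: congruence_def)
  then show ?case
    using c congruence_carrier[OF cong incl.prems] by (simp add: left_translation_apply)
next
  case (inv h)
  then obtain c where c: "c \<in> carrier Q" "h = left_translation Q c" by blast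
  have "(c, c) \<in> \<alpha>"
    using cong c(1) by (auto simp: congruence_def equiv_def refl_on_def)
  then have "(c \<bsol> a, c \<bsol> b) \<in> \<alpha>"
    using cong inv.prems by (auto simp: congruence_def)
  then show ?case
    using c congruence_carrier[OF cong inv.prems] by (simp add: inv_left_translation_apply)
next
  case (eng h1 h2)
  have "h1 \<in> carrier (Sym Q)" "h2 \<in> carrier (Sym Q)"
    using eng.hyps LMlt_closed unfolding LMlt_def by blast+
  then show ?case
    using eng.IH eng.prems congruence_carrier[OF cong eng.prems] by (simp add: Sym_mult_apply)
qed

end

context rack
begin

lemma left_translation_mult:
  assumes a: "a \<in> carrier Q" and b: "b \<in> carrier Q"
  shows "left_translation Q (a \<ast> b) =
    left_translation Q a \<otimes>\<^bsub>Sym Q\<^esub> left_translation Q b \<otimes>\<^bsub>Sym Q\<^esub> inv\<^bsub>Sym Q\<^esub> left_translation Q a"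
proof -
  have "left_translation Q (a \<ast> b) \<otimes>\<^bsub>Sym Q\<^esub> left_translation Q a =
      left_translation Q a \<otimes>\<^bsub>Sym Q\<^esub> left_translation Q b"
    using a b
    by (intro Sym_eqI)
      (simp_all add: left_translation_closed mult_closed Sym_mult_apply left_translation_apply
        left_distrib[symmetric])
  then show ?thesis
    using a b by (metis Sym.inv_solve_right Sym.m_closed left_translation_closed mult_closed)
qed

lemma left_translation_div:
  assumes a: "a \<in> carrier Q" and b: "b \<in> carrier Q"
  shows "left_translation Q (a \<bsol> b) =
    inv\<^bsub>Sym Q\<^esub> left_translation Q a \<otimes>\<^bsub>Sym Q\<^esub> left_translation Q b \<otimes>\<^bsub>Sym Q\<^esub> left_translation Q a"
proof -
  let ?L = "left_translation Q"
  have "?L b = ?L a \<otimes>\<^bsub>Sym Q\<^esub> ?L (a \<bsol> b) \<otimes>\<^bsub>Sym Q\<^esub> inv\<^bsub>Sym Q\<^esub> ?L a"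
    using left_translation_mult[of a "a \<bsol> b"] a b by (simp add: div_closed mult_div)
  then have "?L b \<otimes>\<^bsub>Sym Q\<^esub> ?L a = ?L a \<otimes>\<^bsub>Sym Q\<^esub> ?L (a \<bsol> b)"
    using a b by (metis Sym.inv_solve_right Sym.m_closed left_translation_closed div_closed)
  then have "?L (a \<bsol> b) = inv\<^bsub>Sym Q\<^esub> ?L a \<otimes>\<^bsub>Sym Q\<^esub> (?L b \<otimes>\<^bsub>Sym Q\<^esub> ?L a)"
    using a b by (metis Sym.inv_solve_left Sym.m_closed left_translation_closed div_closed)
  then show ?thesis
    using a b by (metis Sym.m_assoc Sym.inv_closed left_translation_closed)
qed

text \<open>The elements of the left multiplication group are automorphisms \<open>f\<close> of \<open>Q\<close>, and an
  automorphism carries translation by \<open>a\<close> to translation by \<open>f a\<close>.\<close>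

lemma conj_left_translation:
  assumes "f \<in> LMlt Q" and "a \<in> carrier Q"
  shows "f \<otimes>\<^bsub>Sym Q\<^esub> left_translation Q a \<otimes>\<^bsub>Sym Q\<^esub> inv\<^bsub>Sym Q\<^esub> f = left_translation Q (f a)"
  using assms unfolding LMlt_def
proof (induction f arbitrary: a rule: generate.induct)
  case one
  then show ?case by (simp add: left_translation_closed Sym_one_apply)
next
  case (incl h)
  then show ?case by (auto simp: left_translation_apply left_translation_mult)
next
  case (inv h)
  then show ?case
    by (auto simp: inv_left_translation_apply left_translation_div left_translation_closed)
next
  case (eng h1 h2)
  have h: "h1 \<in> carrier (Sym Q)" "h2 \<in> carrier (Sym Q)"
    using eng.hyps LMlt_closed unfolding LMlt_def by blast+
  have "(h1 \<otimes>\<^bsub>Sym Q\<^esub> h2) \<otimes>\<^bsub>Sym Q\<^esub> left_translation Q a \<otimes>\<^bsub>Sym Q\<^esub> inv\<^bsub>Sym Q\<^esub> (h1 \<otimes>\<^bsub>Sym Q\<^esub> h2)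
      = h1 \<otimes>\<^bsub>Sym Q\<^esub> (h2 \<otimes>\<^bsub>Sym Q\<^esub> left_translation Q a \<otimes>\<^bsub>Sym Q\<^esub> inv\<^bsub>Sym Q\<^esub> h2)
          \<otimes>\<^bsub>Sym Q\<^esub> inv\<^bsub>Sym Q\<^esub> h1"
    using h eng.prems by (simp add: left_translation_closed Sym.inv_mult_group Sym.m_assoc)
  then show ?case
    using h eng.IH eng.prems by (simp add: Sym_apply_closed Sym_mult_apply)
qed

lemma conj_displacement:
  assumes f: "f \<in> LMlt Q" and a: "a \<in> carrier Q" and b: "b \<in> carrier Q"
  shows "f \<otimes>\<^bsub>Sym Q\<^esub> displacement Q a b \<otimes>\<^bsub>Sym Q\<^esub> inv\<^bsub>Sym Q\<^esub> f = displacement Q (f a) (f b)"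
proof -
  have fc: "f \<in> carrier (Sym Q)" using f by (rule LMlt_closed)
  let ?L = "left_translation Q"
  have cancel: "inv\<^bsub>Sym Q\<^esub> f \<otimes>\<^bsub>Sym Q\<^esub> (f \<otimes>\<^bsub>Sym Q\<^esub> g) = g" if "g \<in> carrier (Sym Q)" for g
    using fc that by (simp flip: Sym.m_assoc)
  have "displacement Q (f a) (f b) = (f \<otimes>\<^bsub>Sym Q\<^esub> ?L a \<otimes>\<^bsub>Sym Q\<^esub> inv\<^bsub>Sym Q\<^esub> f)
      \<otimes>\<^bsub>Sym Q\<^esub> inv\<^bsub>Sym Q\<^esub> (f \<otimes>\<^bsub>Sym Q\<^esub> ?L b \<otimes>\<^bsub>Sym Q\<^esub> inv\<^bsub>Sym Q\<^esub> f)"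
    using f a b by (simp add: displacement_def conj_left_translation)
  also have "\<dots> = f \<otimes>\<^bsub>Sym Q\<^esub> displacement Q a b \<otimes>\<^bsub>Sym Q\<^esub> inv\<^bsub>Sym Q\<^esub> f"
    using fc a b
    by (simp add: displacement_def left_translation_closed Sym.inv_mult_group Sym.m_assoc cancel)
  finally show ?thesis by simp
qed

section \<open>Both maps are well defined\<close>

lemma Dis_cong_in_Norm:
  assumes cong: "congruence Q \<alpha>"
  shows "Dis_cong Q \<alpha> \<in> carrier (Norm Q)"
proof -
  let ?K = "{displacement Q a b | a b. (a, b) \<in> \<alpha>}"
  interpret H: group "Sym Q\<lparr>carrier := LMlt Q\<rparr>" by (rule group_LMlt)
  have K: "?K \<subseteq> LMlt Q"
    by (auto dest: congruence_carrier[OF cong] intro: displacement_in_LMlt)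
  have "generate (Sym Q\<lparr>carrier := LMlt Q\<rparr>) ?K \<lhd> Sym Q\<lparr>carrier := LMlt Q\<rparr>"
  proof (rule H.normal_generateI)
    show "?K \<subseteq> carrier (Sym Q\<lparr>carrier := LMlt Q\<rparr>)" using K by simp
  next
    fix h g assume h: "h \<in> ?K" and g: "g \<in> carrier (Sym Q\<lparr>carrier := LMlt Q\<rparr>)"
    from h obtain a b where ab: "(a, b) \<in> \<alpha>" "h = displacement Q a b" by blast
    then have "g \<otimes>\<^bsub>Sym Q\<^esub> h \<otimes>\<^bsub>Sym Q\<^esub> inv\<^bsub>Sym Q\<^esub> g = displacement Q (g a) (g b)"
      using g congruence_carrier[OF cong] by (simp add: conj_displacement)
    moreover have "(g a, g b) \<in> \<alpha>"
      using LMlt_preserves_congruence[OF cong _ ab(1)] g by simp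
    ultimately show "g \<otimes>\<^bsub>Sym Q\<lparr>carrier := LMlt Q\<rparr>\<^esub> h
        \<otimes>\<^bsub>Sym Q\<lparr>carrier := LMlt Q\<rparr>\<^esub> inv\<^bsub>Sym Q\<lparr>carrier := LMlt Q\<rparr>\<^esub> g \<in> ?K"
      using g Sym.m_inv_consistent[OF subgroup_LMlt] by auto
  qed
  then have "Dis_cong Q \<alpha> \<lhd> Sym Q\<lparr>carrier := LMlt Q\<rparr>"
    unfolding Dis_cong_def using Sym.generate_consistent[OF K subgroup_LMlt] by simp
  moreover have "subgroup (Dis_cong Q \<alpha>) (Sym Q\<lparr>carrier := Dis Q\<rparr>)"
  proof (rule Sym.subgroup_incl[OF _ subgroup_Dis])
    show "subgroup (Dis_cong Q \<alpha>) (Sym Q)"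
      unfolding Dis_cong_def using K subgroup.subset[OF subgroup_LMlt]
      by (rule Sym.generate_is_subgroup[OF subset_trans])
    show "Dis_cong Q \<alpha> \<subseteq> Dis Q"
      unfolding Dis_cong_def Dis_def
      using congruence_carrier[OF cong] by (intro Sym.mono_generate) blast
  qed
  ultimately show ?thesis by (simp add: Norm_def)
qed

text \<open>Reading membership in \<open>con\<^sub>N\<close> as equality of cosets turns compatibility with the operations
  into the fact that coset multiplication and inversion are well defined.\<close>

lemma con_sub_congruence:
  assumes N: "N \<lhd> Sym Q\<lparr>carrier := LMlt Q\<rparr>"
  shows "congruence Q (con_sub Q N)"
proof -
  define H where "H = Sym Q\<lparr>carrier := LMlt Q\<rparr>"
  interpret N: normal N H using N by (simp add: H_def)
  let ?L = "left_translation Q"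
  have L: "?L a \<in> carrier H" if "a \<in> carrier Q" for a
    using that by (simp add: H_def left_translation_in_LMlt)
  have inv_H: "inv\<^bsub>H\<^esub> f = inv\<^bsub>Sym Q\<^esub> f" if "f \<in> carrier H" for f
    using that Sym.m_inv_consistent[OF subgroup_LMlt] by (simp add: H_def)
  have mult_H: "f \<otimes>\<^bsub>H\<^esub> g = f \<otimes>\<^bsub>Sym Q\<^esub> g" for f g by (simp add: H_def)
  have mem: "(a, b) \<in> con_sub Q N \<longleftrightarrow>
      a \<in> carrier Q \<and> b \<in> carrier Q \<and> N #>\<^bsub>H\<^esub> ?L a = N #>\<^bsub>H\<^esub> ?L b" for a b
  proof (cases "a \<in> carrier Q \<and> b \<in> carrier Q")
    case True
    then have "displacement Q a b \<in> N \<longleftrightarrow> ?L a \<in> N #>\<^bsub>H\<^esub> ?L b"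
      using N.rcos_module[OF N.is_group, of "?L b" "?L a"] L
      by (simp add: displacement_def inv_H mult_H)
    also have "\<dots> \<longleftrightarrow> N #>\<^bsub>H\<^esub> ?L a = N #>\<^bsub>H\<^esub> ?L b"
      using True L N.repr_independence[OF _ _ N.subgroup_axioms]
        N.rcos_self[OF _ N.subgroup_axioms] by metis
    finally show ?thesis using True by (simp add: con_sub_def)
  qed (auto simp: con_sub_def)
  have coset_mult: "N #>\<^bsub>H\<^esub> ?L (a \<ast> c) =
      (N #>\<^bsub>H\<^esub> ?L a) <#>\<^bsub>H\<^esub> (N #>\<^bsub>H\<^esub> ?L c) <#>\<^bsub>H\<^esub> set_inv\<^bsub>H\<^esub> (N #>\<^bsub>H\<^esub> ?L a)"
    if "a \<in> carrier Q" "c \<in> carrier Q" for a c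
    using that L by (simp add: left_translation_mult N.rcos_sum N.rcos_inv flip: inv_H mult_H)
  have coset_div: "N #>\<^bsub>H\<^esub> ?L (a \<bsol> c) =
      set_inv\<^bsub>H\<^esub> (N #>\<^bsub>H\<^esub> ?L a) <#>\<^bsub>H\<^esub> (N #>\<^bsub>H\<^esub> ?L c) <#>\<^bsub>H\<^esub> (N #>\<^bsub>H\<^esub> ?L a)"
    if "a \<in> carrier Q" "c \<in> carrier Q" for a c
    using that L by (simp add: left_translation_div N.rcos_sum N.rcos_inv flip: inv_H mult_H)
  have "equiv (carrier Q) (con_sub Q N)"
    by (rule equivI) (auto simp: refl_on_def sym_def trans_def mem)
  then show ?thesis
    unfolding congruence_def
    by (auto simp: mem coset_mult coset_div mult_closed div_closed)
qed

section \<open>The adjunction\<close>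

lemma Dis_cong_subset_iff:
  assumes \<alpha>: "\<alpha> \<subseteq> carrier Q \<times> carrier Q" and N: "subgroup N (Sym Q)"
  shows "Dis_cong Q \<alpha> \<subseteq> N \<longleftrightarrow> \<alpha> \<subseteq> con_sub Q N"
proof
  assume "Dis_cong Q \<alpha> \<subseteq> N"
  then show "\<alpha> \<subseteq> con_sub Q N"
    using \<alpha> unfolding Dis_cong_def con_sub_def by (blast intro: generate.incl)
next
  assume "\<alpha> \<subseteq> con_sub Q N"
  then show "Dis_cong Q \<alpha> \<subseteq> N"
    unfolding Dis_cong_def con_sub_def by (intro Sym.generate_subgroup_incl[OF _ N]) blast
qed

end

lemma partial_order_Con: "partial_order (Con Q)"
  by unfold_locales (auto simp: Con_def)

lemma partial_order_Norm: "partial_order (Norm Q)"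
  by unfold_locales (auto simp: Norm_def)

theorem proposition3p6:
  fixes Q :: "('a, 'b) lquasigroup_scheme"
  assumes "rack Q"
  shows "isotone (Con Q) (Norm Q) (Dis_cong Q) \<and>
         isotone (Norm Q) (Con Q) (con_sub Q) \<and>
         galois_connection
           \<lparr>orderA = Con Q, orderB = Norm Q, lower = Dis_cong Q, upper = con_sub Q\<rparr>"
proof -
  interpret rack Q by (rule assms)
  let ?G = "\<lparr>orderA = Con Q, orderB = Norm Q, lower = Dis_cong Q, upper = con_sub Q\<rparr>"
  have gc: "galois_connection ?G"
  proof (intro galois_connection.intro connection.intro galois_connection_axioms.intro)
    show "partial_order \<X>\<^bsub>?G\<^esub>" by (simp add: partial_order_Con)
    show "partial_order \<Y>\<^bsub>?G\<^esub>" by (simp add: partial_order_Norm)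
    show "\<pi>\<^sup>*\<^bsub>?G\<^esub> \<in> carrier \<X>\<^bsub>?G\<^esub> \<rightarrow> carrier \<Y>\<^bsub>?G\<^esub>"
      using Dis_cong_in_Norm by (auto simp: Con_def)
    show "\<pi>\<^sub>*\<^bsub>?G\<^esub> \<in> carrier \<Y>\<^bsub>?G\<^esub> \<rightarrow> carrier \<X>\<^bsub>?G\<^esub>"
      using con_sub_congruence by (auto simp: Con_def Norm_def)
  next
    fix \<alpha> N assume "\<alpha> \<in> carrier \<X>\<^bsub>?G\<^esub>" and "N \<in> carrier \<Y>\<^bsub>?G\<^esub>"
    then have "\<alpha> \<subseteq> carrier Q \<times> carrier Q" "subgroup N (Sym Q)"
      using congruence_carrier Sym.incl_subgroup[OF subgroup_Dis]
      by (auto simp: Con_def Norm_def)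
    then show "\<pi>\<^sup>*\<^bsub>?G\<^esub> \<alpha> \<sqsubseteq>\<^bsub>\<Y>\<^bsub>?G\<^esub>\<^esub> N \<longleftrightarrow> \<alpha> \<sqsubseteq>\<^bsub>\<X>\<^bsub>?G\<^esub>\<^esub> \<pi>\<^sub>*\<^bsub>?G\<^esub> N"
      using Dis_cong_subset_iff by (simp add: Con_def Norm_def)
  qed
  then show ?thesis
    using galois_connection.lower_iso[OF gc] galois_connection.upper_iso[OF gc] by simp
qed

end
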